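(* Let $C=(S_1,\dots,S_N)$ be a sequence of reasoning steps leading to a final answer $A$, all regarded as jointly distributed discrete random variables. For any subset $\tilde S=\{S_{k_0},S_{k_1},\dots,S_{k_K}\}\subseteq C$ of $K+1$ steps (with $k_0,\dots,k_K\in\{1,\dots,N\}$ distinct indices), the conditional mutual information between $\tilde S$ and $A$ given the remaining steps $C\setminus\tilde S$ satisfies $$I(\tilde S;A\mid C\setminus\tilde S)\;\le\;\sum_{i=0}^{K} H(S_{k_i}\mid S_{<k_i}),$$ where $H(S_j\mid S_{<j})$ denotes the step entropy of the step $S_j$.
   Context: Setting: a language model generates a chain of thought $C=(S_1,\dots,S_N)$ and then a final answer $A$. Let $V$ be a finite vocabulary. Each step $S_i=(t_{i,1},\dots,t_{i,M_i})$ is a sequence of $M_i$ random tokens with values in $V$, and $A$ is a discrete random variable (values in a countable set). $N$ and the $M_i$ are fixed positive integers. The variables $S_1,\dots,S_N,A$ have an arbitrary joint distribution on a common probability space; the input prompt is fixed. Notation: $S_{<j}=(S_1,\dots,S_{j-1})$ (empty for $j=1$). The context $c_{i,j}$ of token $t_{i,j}$ consists of the (fixed) input prompt and all previously generated tokens, i.e. $S_{<i}$ and $t_{i,1},\dots,t_{i,j-1}$. $C\setminus\tilde S$ is the tuple of all steps of $C$ not in $\tilde S$. Entropy: all entropies are Shannon entropies with logarithm base 2. $H(X\mid Y)$ is the conditional Shannon entropy (averaged over the distribution of $Y$), and $I(X;Y\mid Z)=H(X\mid Z)-H(X\mid Y,Z)$. Step entropy (not length-normalized): $$H(S_i\mid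 S_{<i})=\sum_{j=1}^{M_i}H(t_{i,j}\mid c_{i,j})=H(t_{i,1},\dots,t_{i,M_i}\mid S_{<i}),$$ that is, the conditional Shannon entropy of $S_i$ given all earlier steps. *)

theory Defs
  imports "HOL-Probability.Probability"
begin

text \<open>
  The library's Shannon quantities in base 2. As with the library's abbreviations for discrete
  random variables, the range of each variable carries the counting measure.
\<close>

definition cond_entropy :: "'w measure \<Rightarrow> ('w \<Rightarrow> 'x) \<Rightarrow> ('w \<Rightarrow> 'y) \<Rightarrow> real" where
  "cond_entropy P X Y =
    prob_space.conditional_entropy P 2
      (count_space (X ` space P)) (count_space (Y ` space P)) X Y"

definition cond_mutual_info ::
    "'w measure \<Rightarrow> ('w \<Rightarrow> 'x) \<Rightarrow> ('w \<Rightarrow> 'y) \<Rightarrow> ('w \<Rightarrow> 'z) \<Rightarrow> real" where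
  "cond_mutual_info P X Y Z =
    prob_space.conditional_mutual_information P 2
      (count_space (X ` space P)) (count_space (Y ` space P)) (count_space (Z ` space P)) X Y Z"

text \<open>
  \<open>t i j\<close> is the \<open>j\<close>-th token of the \<open>i\<close>-th step and \<open>m i\<close> the length of the \<open>i\<close>-th step; both
  indices start at 1. The input prompt is fixed, so it is not recorded in the context of a token.
\<close>

definition step :: "(nat \<Rightarrow> nat \<Rightarrow> 'w \<Rightarrow> 'v) \<Rightarrow> (nat \<Rightarrow> nat) \<Rightarrow> nat \<Rightarrow> 'w \<Rightarrow> 'v list" where
  "step t m i = (\<lambda>\<omega>. map (\<lambda>j. t i j \<omega>) [1..<Suc (m i)])"

definition earlier_steps ::
    "(nat \<Rightarrow> nat \<Rightarrow> 'w \<Rightarrow> 'v) \<Rightarrow> (nat \<Rightarrow> nat) \<Rightarrow> nat \<Rightarrow> 'w \<Rightarrow> 'v list list" where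
  "earlier_steps t m i = (\<lambda>\<omega>. map (\<lambda>l. step t m l \<omega>) [1..<i])"

definition token_context ::
    "(nat \<Rightarrow> nat \<Rightarrow> 'w \<Rightarrow> 'v) \<Rightarrow> (nat \<Rightarrow> nat) \<Rightarrow> nat \<Rightarrow> nat \<Rightarrow> 'w \<Rightarrow> 'v list list \<times> 'v list" where
  "token_context t m i j = (\<lambda>\<omega>. (earlier_steps t m i \<omega>, map (\<lambda>l. t i l \<omega>) [1..<j]))"

definition step_entropy ::
    "'w measure \<Rightarrow> (nat \<Rightarrow> nat \<Rightarrow> 'w \<Rightarrow> 'v) \<Rightarrow> (nat \<Rightarrow> nat) \<Rightarrow> nat \<Rightarrow> real" where
  "step_entropy P t m i = (\<Sum>j=1..m i. cond_entropy P (t i j) (token_context t m i j))"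

text \<open>
  A set of steps is given by its set \<open>J\<close> of positions and treated as the tuple of these steps,
  so that steps at different positions are kept apart even when their values coincide.
\<close>

definition step_tuple ::
    "(nat \<Rightarrow> nat \<Rightarrow> 'w \<Rightarrow> 'v) \<Rightarrow> (nat \<Rightarrow> nat) \<Rightarrow> nat set \<Rightarrow> 'w \<Rightarrow> nat \<Rightarrow> 'v list" where
  "step_tuple t m J = (\<lambda>\<omega>. \<lambda>i\<in>J. step t m i \<omega>)"

lemma (in prob_space) distributed_countable:
  assumes "countable B" and X: "X \<in> M \<rightarrow>\<^sub>M count_space B"
  shows "distributed M (count_space B) X (\<lambda>x. prob {\<omega>\<in>space M. X \<omega> = x})"
  unfolding distributed_def
proof (intro conjI X)
  have Xs: "X -` {x} \<inter> space M = {\<omega>\<in>space M. X \<omega> = x}" for x by auto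
  show "distr M (count_space B) X = density (count_space B) (\<lambda>x. ennreal (prob {\<omega>\<in>space M. X \<omega> = x}))"
  proof (rule measure_eqI_countable[where A=B])
    fix a assume "a \<in> B"
    then show "emeasure (distr M (count_space B) X) {a}
        = emeasure (density (count_space B) (\<lambda>x. ennreal (prob {\<omega>\<in>space M. X \<omega> = x}))) {a}"
      using X by (simp add: emeasure_distr emeasure_density Xs emeasure_eq_measure nn_integral_count_space_indicator max_def one_ennreal_def[symmetric])
  qed (use assms in auto)
qed simp

lemma (in information_space) countable_cond_entropy:
  assumes B: "finite B1" "countable B2"
    and X: "X \<in> M \<rightarrow>\<^sub>M count_space B1" and Y: "Y \<in> M \<rightarrow>\<^sub>M count_space B2"
  defines "p \<equiv> (\<lambda>x. prob {\<omega>\<in>space M. X \<omega> = x})"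
      and "q \<equiv> (\<lambda>y. prob {\<omega>\<in>space M. Y \<omega> = y})"
      and "r \<equiv> (\<lambda>z. prob {\<omega>\<in>space M. (X \<omega>, Y \<omega>) = z})"
  shows "conditional_entropy b (count_space B1) (count_space B2) X Y
           = - expectation (\<lambda>\<omega>. log b (r (X \<omega>, Y \<omega>) / q (Y \<omega>)))" (is ?CE)
    and "mutual_information b (count_space B1) (count_space B2) X Y
           = - expectation (\<lambda>\<omega>. log b (p (X \<omega>))) + expectation (\<lambda>\<omega>. log b (r (X \<omega>, Y \<omega>) / q (Y \<omega>)))" (is ?MI)
proof -
  let ?S = "count_space B1" and ?T = "count_space B2"
  have cB1: "countable B1" using B by (simp add: countable_finite)
  interpret S: sigma_finite_measure ?S by (rule sigma_finite_measure_count_space_countable[OF cB1])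
  interpret T: sigma_finite_measure ?T by (rule sigma_finite_measure_count_space_countable[OF B(2)])
  interpret ST: pair_sigma_finite ?S ?T ..
  have ST: "?S \<Otimes>\<^sub>M ?T = count_space (B1 \<times> B2)"
    by (rule pair_measure_countable[OF cB1 B(2)])
  have XY: "(\<lambda>\<omega>. (X \<omega>, Y \<omega>)) \<in> M \<rightarrow>\<^sub>M ?S \<Otimes>\<^sub>M ?T" using X Y by (rule measurable_Pair)
  have dX: "distributed M ?S X p" unfolding p_def using distributed_countable[OF cB1 X] .
  have dY: "distributed M ?T Y q" unfolding q_def using distributed_countable[OF B(2) Y] .
  have dXY: "distributed M (?S \<Otimes>\<^sub>M ?T) (\<lambda>\<omega>. (X \<omega>, Y \<omega>)) r"
    unfolding r_def ST by (rule distributed_countable) (use cB1 B XY ST in auto)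
  have nn [simp]: "0 \<le> p x" "0 \<le> q y" "0 \<le> r z" for x y z by (auto simp: p_def q_def r_def)
  have setM: "{\<omega>\<in>space M. X \<omega> = x} \<in> events" "{\<omega>\<in>space M. Y \<omega> = y} \<in> events" if "x \<in> B1" "y \<in> B2" for x y
    using measurable_sets[OF X, of "{x}"] measurable_sets[OF Y, of "{y}"] that
    by (auto simp: vimage_def Int_def conj_commute)
  have rp: "r (x, y) \<le> p x" and rq: "r (x, y) \<le> q y" if "x \<in> B1" "y \<in> B2" for x y
    unfolding r_def p_def q_def using setM[OF that] by (auto intro!: finite_measure_mono)
  have CE: "conditional_entropy b ?S ?T X Y = - (\<integral>(x, y). r (x, y) * log b (r (x, y) / q y) \<partial>(?S \<Otimes>\<^sub>M ?T))"
    by (rule conditional_entropy_generic_eq[OF _ _ dY _ dXY]) (auto intro: S.sigma_finite_measure_axioms T.sigma_finite_measure_axioms)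
  have MI: "mutual_information b ?S ?T X Y = (\<integral>z. r z * log b (r z / (p (fst z) * q (snd z))) \<partial>(?S \<Otimes>\<^sub>M ?T))"
    by (rule mutual_information_distr[OF _ _ dX _ dY _ dXY]) (auto intro: S.sigma_finite_measure_axioms T.sigma_finite_measure_axioms)
  have mf: "f \<in> borel_measurable (?S \<Otimes>\<^sub>M ?T)" for f :: "_ \<Rightarrow> real" by (simp add: ST)
  have int_q: "integrable (?S \<Otimes>\<^sub>M ?T) (\<lambda>z. q (snd z))"
  proof (rule integrableI_bounded)
    have "(\<integral>\<^sup>+ z. ennreal (norm (q (snd z))) \<partial>(?S \<Otimes>\<^sub>M ?T)) = (\<integral>\<^sup>+ x. (\<integral>\<^sup>+ y. ennreal (q y) \<partial>?T) \<partial>?S)"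
      by (subst T.nn_integral_fst[symmetric]) (auto simp: ST)
    also have "(\<integral>\<^sup>+ y. ennreal (q y) \<partial>?T) = 1"
    proof -
      have "(\<integral>\<^sup>+ y. ennreal (q y) \<partial>?T) = emeasure (density ?T q) (space ?T)"
        by (subst emeasure_density) (auto intro!: nn_integral_cong)
      also have "\<dots> = emeasure (distr M ?T Y) (space ?T)"
        using dY by (simp add: distributed_def)
      also have "\<dots> = 1" using prob_space.emeasure_space_1[OF prob_space_distr[OF Y]] by simp
      finally show ?thesis .
    qed
    also have "(\<integral>\<^sup>+ x. 1 \<partial>?S) < \<infinity>" using B by (simp add: emeasure_count_space_finite of_nat_less_top)
    finally show "(\<integral>\<^sup>+ z. ennreal (norm (q (snd z))) \<partial>(?S \<Otimes>\<^sub>M ?T)) < \<infinity>" .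
  qed (rule mf)
  have bnd: "norm (r (x, y) * log b (r (x, y) / q y)) \<le> norm (q y / ln b)" if "x \<in> B1" "y \<in> B2" for x y
  proof (cases "r (x, y) = 0")
    case False
    then have r0: "0 < r (x, y)" using nn(3)[of "(x, y)"] by linarith
    with rq[OF that] have q0: "0 < q y" by linarith
    let ?u = "r (x, y) / q y"
    have u: "0 < ?u" "?u \<le> 1" using r0 q0 rq[OF that] by auto
    have lb: "0 < ln b" using b_gt_1 by simp
    have "- ln u \<le> 1 / u" if "0 < u" for u :: real
      using ln_le_minus_one[of "1 / u"] that by (simp add: ln_div)
    from this[OF u(1)] have "- ln ?u \<le> 1 / ?u" .
    then have "r (x, y) * - ln ?u \<le> r (x, y) * (1 / ?u)" using r0 by (intro mult_left_mono) auto
    also have "\<dots> = q y" using r0 by simp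
    finally have "r (x, y) * - ln ?u / ln b \<le> q y / ln b" using lb by (intro divide_right_mono) auto
    moreover have "ln ?u \<le> 0" using u by simp
    ultimately show ?thesis using r0 lb q0
      by (simp add: log_def abs_mult abs_of_nonpos)
  qed simp
  have int1: "integrable (?S \<Otimes>\<^sub>M ?T) (\<lambda>z. r z * log b (r z / q (snd z)))"
  proof (rule Bochner_Integration.integrable_bound[OF _ mf])
    show "integrable (?S \<Otimes>\<^sub>M ?T) (\<lambda>z. q (snd z) / ln b)" using int_q by simp
    show "AE z in ?S \<Otimes>\<^sub>M ?T. norm (r z * log b (r z / q (snd z))) \<le> norm (q (snd z) / ln b)"
      unfolding ST AE_count_space using bnd by force
  qed
  have E1: "expectation (\<lambda>\<omega>. log b (r (X \<omega>, Y \<omega>) / q (Y \<omega>))) = (\<integral>z. r z * log b (r z / q (snd z)) \<partial>(?S \<Otimes>\<^sub>M ?T))"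
    using distributed_integral[OF dXY mf, of "\<lambda>z. log b (r z / q (snd z))"] by simp
  show ?CE unfolding CE E1 by (simp add: split_beta')
  have i1: "integrable M (\<lambda>\<omega>. log b (r (X \<omega>, Y \<omega>) / q (Y \<omega>)))"
    using distributed_integrable[OF dXY mf, of "\<lambda>z. log b (r z / q (snd z))"] int1 by simp
  have i2: "integrable M (\<lambda>\<omega>. log b (p (X \<omega>)))"
    using distributed_integrable[OF dX, of "\<lambda>x. log b (p x)"] B by (auto intro: integrable_count_space)
  have pos: "AE z in (?S \<Otimes>\<^sub>M ?T). r z * log b (r z / (p (fst z) * q (snd z))) = r z * (log b (r z / q (snd z)) - log b (p (fst z)))"
  proof -
    have "r (x, y) * log b (r (x, y) / (p x * q y)) = r (x, y) * (log b (r (x, y) / q y) - log b (p x))"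
      if "x \<in> B1" "y \<in> B2" for x y
    proof (cases "r (x, y) = 0")
      case False
      then have "0 < r (x, y)" using nn(3)[of "(x, y)"] by linarith
      with rp[OF that] rq[OF that] have "0 < p x" "0 < q y" "0 < r (x, y)" by linarith+
      then show ?thesis using b_gt_1 by (simp add: log_divide log_mult)
    qed simp
    then show ?thesis unfolding ST AE_count_space by force
  qed
  have "mutual_information b ?S ?T X Y = (\<integral>z. r z * (log b (r z / q (snd z)) - log b (p (fst z))) \<partial>(?S \<Otimes>\<^sub>M ?T))"
    unfolding MI by (rule integral_cong_AE[OF mf mf pos])
  also have "\<dots> = expectation (\<lambda>\<omega>. log b (r (X \<omega>, Y \<omega>) / q (Y \<omega>)) - log b (p (X \<omega>)))"
    using distributed_integral[OF dXY mf, of "\<lambda>z. log b (r z / q (snd z)) - log b (p (fst z))"] by simp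
  finally show ?MI using i1 i2 by simp
qed


lemma measurable_count_space_range:
  assumes "countable B" "X \<in> P \<rightarrow>\<^sub>M count_space B"
  shows "countable (X ` space P)" "X \<in> P \<rightarrow>\<^sub>M count_space (X ` space P)"
proof -
  have sub: "X ` space P \<subseteq> B" using measurable_space[OF assms(2)] by auto
  then show c: "countable (X ` space P)" using assms(1) by (rule countable_subset)
  have "X -` {a} \<inter> space P \<in> sets P" if "a \<in> X ` space P" for a
    using that sub by (intro measurable_sets[OF assms(2)]) auto
  then show "X \<in> P \<rightarrow>\<^sub>M count_space (X ` space P)"
    using c by (auto simp: measurable_count_space_eq_countable)
qed

text \<open>
  The library takes \<open>I(X;(Y,Z)) - I(X;Z)\<close> as the definition of \<open>I(X;Y|Z)\<close>, each term being a
  Kullback-Leibler divergence. For \<open>X\<close> and \<open>Z\<close> with finite range and \<open>Y\<close> with countable range,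
  possibly of infinite entropy, this is \<open>H(X|Z) - H(X|Y,Z)\<close>.
\<close>

lemma cond_mutual_info_eq:
  assumes "prob_space P" and X: "simple_function P X" and Z: "simple_function P Z"
    and B: "countable B" and Y: "Y \<in> P \<rightarrow>\<^sub>M count_space B"
  shows "cond_mutual_info P X Y Z = cond_entropy P X Z - cond_entropy P X (\<lambda>\<omega>. (Y \<omega>, Z \<omega>))"
proof -
  interpret prob_space P by fact
  interpret information_space P 2 by standard simp
  let ?YZ = "\<lambda>\<omega>. (Y \<omega>, Z \<omega>)"
  note Y' = measurable_count_space_range[OF B Y]
  have fX: "finite (X ` space P)" and fZ: "finite (Z ` space P)"
    using X Z by (auto dest: simple_functionD)
  have mX: "X \<in> P \<rightarrow>\<^sub>M count_space (X ` space P)" and mZ: "Z \<in> P \<rightarrow>\<^sub>M count_space (Z ` space P)"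
    using X Z by (auto simp: simple_function_def measurable_count_space_eq2)
  have prod: "count_space (Y ` space P) \<Otimes>\<^sub>M count_space (Z ` space P) = count_space (Y ` space P \<times> Z ` space P)"
    using Y' fZ by (intro pair_measure_countable) (auto simp: countable_finite)
  have c: "countable (Y ` space P \<times> Z ` space P)"
    using Y' fZ by (simp add: countable_finite)
  have mYZ: "?YZ \<in> P \<rightarrow>\<^sub>M count_space (Y ` space P \<times> Z ` space P)"
    unfolding prod[symmetric] using Y'(2) mZ by (rule measurable_Pair)
  note YZ' = measurable_count_space_range[OF c mYZ]
  show ?thesis
    unfolding cond_mutual_info_def cond_entropy_def conditional_mutual_information_def prod
    unfolding countable_cond_entropy[OF fX countable_finite[OF fZ] mX mZ]
      countable_cond_entropy[OF fX c mX mYZ] countable_cond_entropy[OF fX YZ' (1) mX YZ'(2)]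
    by simp
qed

lemma simple_function_map:
  assumes "\<And>l. l \<in> set xs \<Longrightarrow> simple_function P (\<lambda>\<omega>. f l \<omega>)"
  shows "simple_function P (\<lambda>\<omega>. map (\<lambda>l. f l \<omega>) xs)"
  using assms
proof (induction xs)
  case (Cons a xs)
  then show ?case
    using simple_function_compose2[of P "f a" "\<lambda>\<omega>. map (\<lambda>l. f l \<omega>) xs" "(#)"] by simp
qed simp

lemma (in information_space) conditional_entropy_list_chain:
  fixes T :: "nat \<Rightarrow> 'a \<Rightarrow> 'c"
  assumes Z: "simple_function M Z"
    and T: "\<And>j. j \<in> {1..n} \<Longrightarrow> simple_function M (T j)"
  shows "\<H>((\<lambda>\<omega>. map (\<lambda>j. T j \<omega>) [1..<Suc n]) | Z)
           = (\<Sum>j=1..n. \<H>((T j) | (\<lambda>\<omega>. (Z \<omega>, map (\<lambda>l. T l \<omega>) [1..<j]))))"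
  using T
proof (induction n)
  case 0
  have "\<H>(\<lambda>x. (Z x, [] :: 'c list)) = \<H>((\<lambda>z. (z, [] :: 'c list)) \<circ> Z)" by (simp add: comp_def)
  also have "\<dots> = \<H>(Z)" by (rule entropy_of_inj[OF Z]) (auto simp: inj_on_def)
  finally show ?case using entropy_chain_rule[OF Z, of "\<lambda>_. [] :: 'c list"] by simp
next
  case (Suc n)
  let ?L = "\<lambda>n \<omega>. map (\<lambda>j. T j \<omega>) [1..<Suc n]"
  have L: "simple_function M (?L n)" "simple_function M (?L (Suc n))" and Tn: "simple_function M (T (Suc n))"
    using Suc.prems by (auto intro!: simple_function_map simp del: upt_Suc)
  have ZL: "simple_function M (\<lambda>\<omega>. (Z \<omega>, ?L n \<omega>))" using Z L(1) by (rule simple_function_Pair)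
  let ?g = "\<lambda>((z, l), x). (z, l @ [x])"
  have "\<H>(\<lambda>\<omega>. (Z \<omega>, ?L (Suc n) \<omega>)) = \<H>(?g \<circ> (\<lambda>\<omega>. ((Z \<omega>, ?L n \<omega>), T (Suc n) \<omega>)))"
    by (simp add: comp_def)
  also have "\<dots> = \<H>(\<lambda>\<omega>. ((Z \<omega>, ?L n \<omega>), T (Suc n) \<omega>))"
    by (rule entropy_of_inj[OF simple_function_Pair[OF ZL Tn]]) (auto simp: inj_on_def)
  finally show ?case
    using entropy_chain_rule[OF Z L(2)] entropy_chain_rule[OF Z L(1)] entropy_chain_rule[OF ZL Tn] Suc
    by simp
qed

lemma step_entropy_eq:
  assumes "prob_space P" and "finite V"
    and T: "\<And>l j. l \<in> {1..i} \<Longrightarrow> j \<in> {1..m l} \<Longrightarrow> t l j \<in> P \<rightarrow>\<^sub>M count_space V"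
    and "1 \<le> i"
  shows "step_entropy P t m i = cond_entropy P (step t m i) (earlier_steps t m i)"
proof -
  interpret prob_space P by fact
  interpret information_space P 2 by standard simp
  have sT: "simple_function P (t l j)" if "l \<in> {1..i}" "j \<in> {1..m l}" for l j
  proof -
    have "t l j ` space P \<subseteq> V" using measurable_space[OF T[OF that]] by auto
    then have "finite (t l j ` space P)" using \<open>finite V\<close> by (rule finite_subset)
    moreover have "t l j \<in> P \<rightarrow>\<^sub>M count_space (t l j ` space P)"
      by (rule measurable_count_space_range(2)[OF countable_finite[OF \<open>finite V\<close>] T[OF that]])
    ultimately show ?thesis by (simp add: simple_function_def measurable_count_space_eq2)
  qed
  have "simple_function P (earlier_steps t m i)"
    unfolding earlier_steps_def step_def
    by (intro simple_function_map sT) auto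
  from conditional_entropy_list_chain[OF this, of "m i" "t i"] sT \<open>1 \<le> i\<close>
  show ?thesis
    unfolding step_entropy_def cond_entropy_def token_context_def step_def by simp
qed

end

theory Submission
  imports Defs
begin

text \<open>
  Discarding \<open>H(X | A, Z) \<ge> 0\<close> bounds the mutual information by \<open>H(X | Z) = H(C) - H(Z)\<close>, where
  \<open>X\<close> is the tuple of selected steps, \<open>Z\<close> the tuple of the others and \<open>C\<close> the whole chain. Expand
  both entropies by the chain rule in the order of the chain: a step of \<open>Z\<close> contributes at least as
  much to \<open>H(Z)\<close> as to \<open>H(C)\<close>, because there it is conditioned on fewer steps. What remains are
  the step entropies of the selected steps.
\<close>

text \<open>The conditional entropy is the expectation of minus the log of a conditional
  probability, and that probability is at most 1. Working with this expectation covers a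
  \<open>Y\<close> of infinite entropy, where a difference of entropies would be
  meaningless.\<close>

lemma (in information_space) countable_cond_entropy_nonneg:
  assumes B: "finite B1" "countable B2"
    and X: "X \<in> M \<rightarrow>\<^sub>M count_space B1" and Y: "Y \<in> M \<rightarrow>\<^sub>M count_space B2"
  shows "0 \<le> conditional_entropy b (count_space B1) (count_space B2) X Y"
proof -
  let ?r = "\<lambda>\<omega>. prob {\<omega>'\<in>space M. (X \<omega>', Y \<omega>') = (X \<omega>, Y \<omega>)}"
  let ?q = "\<lambda>\<omega>. prob {\<omega>'\<in>space M. Y \<omega>' = Y \<omega>}"
  have "log b (?r \<omega> / ?q \<omega>) \<le> 0" if "\<omega> \<in> space M" for \<omega>
  proof (cases "?r \<omega> = 0")
    case False
    have "Y -` {Y \<omega>} \<inter> space M \<in> events"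
      using measurable_space[OF Y that] by (intro measurable_sets[OF Y]) auto
    then have "{\<omega>'\<in>space M. Y \<omega>' = Y \<omega>} \<in> events"
      by (simp add: vimage_def Int_def conj_commute)
    then have "?r \<omega> \<le> ?q \<omega>" by (auto intro!: finite_measure_mono)
    moreover have "0 < ?r \<omega>" using False by (simp add: less_le)
    ultimately show ?thesis using b_gt_1 by simp
  \<comment> \<open>Here the quotient is 0, and \<open>log b 0\<close> has the default value
    0.\<close>
  qed (simp add: log_def)
  then have "0 \<le> expectation (\<lambda>\<omega>. - log b (?r \<omega> / ?q \<omega>))"
    by (intro Bochner_Integration.integral_nonneg_AE AE_I2) simp
  then show ?thesis unfolding countable_cond_entropy(1)[OF B X Y] by simp
qed

lemma cond_mutual_info_le_cond_entropy:
  assumes "prob_space P" and X: "simple_function P X" and Z: "simple_function P Z"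
    and B: "countable B" and Y: "Y \<in> P \<rightarrow>\<^sub>M count_space B"
  shows "cond_mutual_info P X Y Z \<le> cond_entropy P X Z"
proof -
  interpret prob_space P by fact
  interpret information_space P 2 by standard simp
  let ?YZ = "\<lambda>\<omega>. (Y \<omega>, Z \<omega>)"
  have fX: "finite (X ` space P)" and fZ: "finite (Z ` space P)"
    using X Z by (auto dest: simple_functionD)
  have mX: "X \<in> P \<rightarrow>\<^sub>M count_space (X ` space P)" and mZ: "Z \<in> P \<rightarrow>\<^sub>M count_space (Z ` space P)"
    using X Z by (auto simp: simple_function_def measurable_count_space_eq2)
  have c: "countable (B \<times> Z ` space P)" using B fZ by (simp add: countable_finite)
  have "?YZ \<in> P \<rightarrow>\<^sub>M count_space (B \<times> Z ` space P)"
    using measurable_Pair[OF Y mZ] pair_measure_countable[OF B countable_finite[OF fZ]] by simp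
  note YZ = measurable_count_space_range[OF c this]
  have "0 \<le> cond_entropy P X ?YZ"
    unfolding cond_entropy_def by (rule countable_cond_entropy_nonneg[OF fX YZ(1) mX YZ(2)])
  then show ?thesis using cond_mutual_info_eq[OF assms] by simp
qed

text \<open>Both mutual informations in the definition contain the entropy of \<open>X\<close>,
  which cancels. This repeats \<open>cond_mutual_info_eq\<close> for finite ranges, in an arbitrary
  base \<open>b\<close> and in the locale where the chain rules live.\<close>

lemma (in information_space) conditional_mutual_information_eq_conditional_entropy_diff:
  assumes X: "simple_function M X" and Y: "simple_function M Y" and Z: "simple_function M Z"
  shows "\<I>(X ; Y | Z) = \<H>(X | Z) - \<H>(X | (\<lambda>\<omega>. (Y \<omega>, Z \<omega>)))"
proof -
  have fin: "finite (X ` space M)" "finite (Y ` space M)" "finite (Z ` space M)"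
    using X Y Z by (auto dest: simple_functionD)
  have meas: "X \<in> M \<rightarrow>\<^sub>M count_space (X ` space M)" "Y \<in> M \<rightarrow>\<^sub>M count_space (Y ` space M)"
    "Z \<in> M \<rightarrow>\<^sub>M count_space (Z ` space M)"
    using X Y Z by (auto simp: simple_function_def measurable_count_space_eq2)
  have prod: "count_space (Y ` space M) \<Otimes>\<^sub>M count_space (Z ` space M)
      = count_space (Y ` space M \<times> Z ` space M)"
    using fin by (intro pair_measure_countable countable_finite)
  have c: "countable (Y ` space M \<times> Z ` space M)" using fin by (simp add: countable_finite)
  have mYZ: "(\<lambda>\<omega>. (Y \<omega>, Z \<omega>)) \<in> M \<rightarrow>\<^sub>M count_space (Y ` space M \<times> Z ` space M)"
    unfolding prod[symmetric] using meas(2,3) by (rule measurable_Pair)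
  note YZ = measurable_count_space_range[OF c mYZ]
  show ?thesis
    \<comment> \<open>The mutual information refers to the product of the ranges of \<open>Y\<close>
      and \<open>Z\<close>, the conditional entropy to the range of the pair. The expectation
      formula is the same for both sets.\<close>
    unfolding conditional_mutual_information_def prod
      countable_cond_entropy[OF fin(1) countable_finite[OF fin(3)] meas(1,3)]
      countable_cond_entropy[OF fin(1) c meas(1) mYZ]
      countable_cond_entropy[OF fin(1) YZ(1) meas(1) YZ(2)]
    by simp
qed

text \<open>Conditioning on less information cannot lower the entropy: the gap is the conditional
  mutual information of \<open>X\<close> and \<open>Y\<close> given
  \<open>f \<circ> Y\<close>.\<close>

lemma (in information_space) conditional_entropy_le_comp:
  assumes X: "simple_function M X" and Y: "simple_function M Y"
  shows "\<H>(X | Y) \<le> \<H>(X | (f \<circ> Y))"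
proof -
  have Z: "simple_function M (f \<circ> Y)" using Y by (rule simple_function_compose)
  note YZ = simple_function_Pair[OF Y Z]
  \<comment> \<open>Adjoining \<open>f \<circ> Y\<close> to \<open>Y\<close> is an injective
    recoding, so conditioning on the pair is conditioning on \<open>Y\<close>.\<close>
  have "\<H>(\<lambda>\<omega>. (Y \<omega>, (f \<circ> Y) \<omega>)) = \<H>((\<lambda>y. (y, f y)) \<circ> Y)" by (simp add: comp_def)
  also have "\<dots> = \<H>(Y)" by (rule entropy_of_inj[OF Y]) (auto simp: inj_on_def)
  finally have 1: "\<H>(\<lambda>\<omega>. (Y \<omega>, (f \<circ> Y) \<omega>)) = \<H>(Y)" .
  have "\<H>(\<lambda>\<omega>. ((Y \<omega>, (f \<circ> Y) \<omega>), X \<omega>)) = \<H>((\<lambda>(y, x). ((y, f y), x)) \<circ> (\<lambda>\<omega>. (Y \<omega>, X \<omega>)))"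
    by (simp add: comp_def)
  also have "\<dots> = \<H>(\<lambda>\<omega>. (Y \<omega>, X \<omega>))"
    by (rule entropy_of_inj[OF simple_function_Pair[OF Y X]]) (auto simp: inj_on_def)
  finally have "\<H>(X | (\<lambda>\<omega>. (Y \<omega>, (f \<circ> Y) \<omega>))) = \<H>(X | Y)"
    using 1 entropy_chain_rule[OF YZ X] entropy_chain_rule[OF Y X] by simp
  moreover have "0 \<le> \<I>(X ; Y | (f \<circ> Y))"
    by (rule conditional_mutual_information_nonneg[OF X Y Z])
  ultimately show ?thesis using conditional_mutual_information_eq_conditional_entropy_diff[OF X Y Z]
    by simp
qed

text \<open>\<open>J\<close> may reach beyond \<open>n\<close>, so that it stays fixed during the
  induction on \<open>n\<close>. Each new position adds a conditional entropy to the left side and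
  one at least as large to the right.\<close>

lemma (in information_space) entropy_list_le_remaining:
  fixes T :: "nat \<Rightarrow> 'a \<Rightarrow> 'c"
  assumes T: "\<And>i. i \<in> {1..n} \<Longrightarrow> simple_function M (T i)"
  shows "\<H>(\<lambda>\<omega>. map (\<lambda>l. T l \<omega>) [1..<Suc n])
           \<le> \<H>(\<lambda>\<omega>. \<lambda>i\<in>{1..n} - J. T i \<omega>)
             + (\<Sum>i\<in>{1..n} \<inter> J. \<H>((T i) | (\<lambda>\<omega>. map (\<lambda>l. T l \<omega>) [1..<i])))"
  using T
proof (induction n)
  case 0
  let ?Z = "\<lambda>\<omega>. \<lambda>i\<in>{1..0} - J. T i \<omega>"
  have "simple_function M ?Z" by (simp add: restrict_def)
  \<comment> \<open>The empty list is a function of the empty tuple, so data processing compares the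
    two without evaluating either entropy.\<close>
  from entropy_data_processing[OF this, of "\<lambda>_. [] :: 'c list"]
  show ?case by (simp add: comp_def del: restrict_apply)
next
  case (Suc n)
  let ?L = "\<lambda>n \<omega>. map (\<lambda>l. T l \<omega>) [1..<Suc n]"
  let ?Z = "\<lambda>n \<omega>. \<lambda>i\<in>{1..n} - J. T i \<omega>"
  let ?S = "T (Suc n)"
  have L: "simple_function M (?L n)" and S: "simple_function M ?S"
    using Suc.prems by (auto intro!: simple_function_map simp del: upt_Suc)
  \<comment> \<open>The remaining tuple is read off the list; positions start at 1, list indices at
    0.\<close>
  let ?f = "\<lambda>l. \<lambda>i\<in>{1..n} - J. l ! (i - 1)"
  have Zf: "?Z n = ?f \<circ> ?L n" by (auto simp: fun_eq_iff restrict_def simp del: upt_Suc)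
  have Z: "simple_function M (?Z n)" unfolding Zf using L by (rule simple_function_compose)
  have IH: "\<H>(?L n) \<le> \<H>(?Z n) + (\<Sum>i\<in>{1..n} \<inter> J. \<H>((T i) | (\<lambda>\<omega>. map (\<lambda>l. T l \<omega>) [1..<i])))"
    using Suc.prems by (intro Suc.IH) auto
  have "\<H>(?L (Suc n)) = \<H>((\<lambda>(l, x). l @ [x]) \<circ> (\<lambda>\<omega>. (?L n \<omega>, ?S \<omega>)))"
    by (simp add: comp_def)
  also have "\<dots> = \<H>(\<lambda>\<omega>. (?L n \<omega>, ?S \<omega>))"
    by (rule entropy_of_inj[OF simple_function_Pair[OF L S]]) (auto simp: inj_on_def)
  finally have LS: "\<H>(?L (Suc n)) = \<H>(?L n) + \<H>(?S | (?L n))"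
    using entropy_chain_rule[OF L S] by simp
  show ?case
  proof (cases "Suc n \<in> J")
    \<comment> \<open>A position in \<open>J\<close> leaves the remaining tuple unchanged, and both
      sides grow by the same term.\<close>
    case True
    then have J: "{1..Suc n} - J = {1..n} - J" "{1..Suc n} \<inter> J = insert (Suc n) ({1..n} \<inter> J)"
      by (auto simp: le_Suc_eq)
    have "(\<Sum>i\<in>{1..Suc n} \<inter> J. \<H>((T i) | (\<lambda>\<omega>. map (\<lambda>l. T l \<omega>) [1..<i])))
        = \<H>(?S | (?L n)) + (\<Sum>i\<in>{1..n} \<inter> J. \<H>((T i) | (\<lambda>\<omega>. map (\<lambda>l. T l \<omega>) [1..<i])))"
      unfolding J by (rule sum.insert) auto
    then show ?thesis using IH LS unfolding J(1) by linarith
  next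
    case False
    then have J: "{1..Suc n} - J = insert (Suc n) ({1..n} - J)" "{1..Suc n} \<inter> J = {1..n} \<inter> J"
      by (auto simp: le_Suc_eq)
    have "\<H>(?Z (Suc n)) = \<H>((\<lambda>(z, x). z(Suc n := x)) \<circ> (\<lambda>\<omega>. (?Z n \<omega>, ?S \<omega>)))"
      unfolding J comp_def by (intro arg_cong[where f="\<lambda>X. \<H>(X)"]) (auto simp: fun_eq_iff)
    also have "\<dots> = \<H>(\<lambda>\<omega>. (?Z n \<omega>, ?S \<omega>))"
    proof (rule entropy_of_inj[OF simple_function_Pair[OF Z S]])
      show "inj_on (\<lambda>(z, x). z(Suc n := x)) ((\<lambda>\<omega>. (?Z n \<omega>, ?S \<omega>)) ` space M)"
      proof (rule inj_onI, elim imageE)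
        fix p q \<omega> \<omega>'
        assume eq: "(case p of (z, x) \<Rightarrow> z(Suc n := x)) = (case q of (z, x) \<Rightarrow> z(Suc n := x))"
          and p: "p = (?Z n \<omega>, ?S \<omega>)" and q: "q = (?Z n \<omega>', ?S \<omega>')"
        have e: "(?Z n \<omega>)(Suc n := ?S \<omega>) = (?Z n \<omega>')(Suc n := ?S \<omega>')"
          using eq unfolding p q prod.case .
        \<comment> \<open>At \<open>Suc n\<close>, outside their domain, both tuples are
          \<open>undefined\<close>; elsewhere the update leaves them untouched.\<close>
        have "?Z n \<omega> i = ?Z n \<omega>' i" for i
          using fun_cong[OF e, of i] by (cases "i = Suc n") auto
        then have "?Z n \<omega> = ?Z n \<omega>'" by (rule ext)
        then show "p = q" unfolding p q using fun_upd_eqD[OF e] by (simp only:)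
      qed
    qed
    finally have ZS: "\<H>(?Z (Suc n)) = \<H>(?Z n) + \<H>(?S | (?Z n))"
      using entropy_chain_rule[OF Z S] by simp
    \<comment> \<open>The new step is conditioned on the whole prefix on the left side, but only on
      a function of it on the right.\<close>
    have "\<H>(?S | (?L n)) \<le> \<H>(?S | (?Z n))"
      unfolding Zf by (rule conditional_entropy_le_comp[OF S L])
    then show ?thesis using IH LS ZS unfolding J(2) by linarith
  qed
qed

text \<open>The chain and its split into selected and remaining steps determine each other, so the
  left side is the entropy of the chain minus that of the remaining tuple.\<close>

lemma (in information_space) conditional_entropy_remaining_le:
  fixes T :: "nat \<Rightarrow> 'a \<Rightarrow> 'c"
  assumes T: "\<And>i. i \<in> {1..n} \<Longrightarrow> simple_function M (T i)"
    and J: "J \<subseteq> {1..n}"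
  shows "\<H>((\<lambda>\<omega>. \<lambda>i\<in>J. T i \<omega>) | (\<lambda>\<omega>. \<lambda>i\<in>{1..n} - J. T i \<omega>))
           \<le> (\<Sum>i\<in>J. \<H>((T i) | (\<lambda>\<omega>. map (\<lambda>l. T l \<omega>) [1..<i])))"
proof -
  let ?L = "\<lambda>\<omega>. map (\<lambda>l. T l \<omega>) [1..<Suc n]"
  let ?E = "\<lambda>J \<omega>. \<lambda>i\<in>J. T i \<omega>"
  have L: "simple_function M ?L"
    using T by (auto intro!: simple_function_map simp del: upt_Suc)
  have E: "simple_function M (?E I)" if "I \<subseteq> {1..n}" for I
  proof -
    have "?E I = (\<lambda>l. \<lambda>i\<in>I. l ! (i - 1)) \<circ> ?L"
      using that by (force simp: fun_eq_iff restrict_def simp del: upt_Suc)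
    then show ?thesis using simple_function_compose[OF L] by metis
  qed
  note EJ = E[OF J] and EJ' = E[OF Diff_subset, of J]
  \<comment> \<open>Merges the two tuples back into the list. It is injective on their values
    because every position up to \<open>n\<close> lies in exactly one domain, and off its domain a
    tuple is \<open>undefined\<close>.\<close>
  let ?g = "\<lambda>(z, x). map (\<lambda>i. if i \<in> J then x i else z i) [1..<Suc n]"
  have "\<H>(?L) = \<H>(?g \<circ> (\<lambda>\<omega>. (?E ({1..n} - J) \<omega>, ?E J \<omega>)))"
    by (intro arg_cong[where f="\<lambda>X. \<H>(X)"]) (auto simp: fun_eq_iff simp del: upt_Suc)
  also have "\<dots> = \<H>(\<lambda>\<omega>. (?E ({1..n} - J) \<omega>, ?E J \<omega>))"
  proof (rule entropy_of_inj[OF simple_function_Pair[OF EJ' EJ]])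
    show "inj_on ?g ((\<lambda>\<omega>. (?E ({1..n} - J) \<omega>, ?E J \<omega>)) ` space M)"
      using J by (auto simp: inj_on_def restrict_def fun_eq_iff subset_iff simp del: upt_Suc)
  qed
  finally have "\<H>((?E J) | (?E ({1..n} - J))) = \<H>(?L) - \<H>(?E ({1..n} - J))"
    using entropy_chain_rule[OF EJ' EJ] by simp
  moreover have "{1..n} \<inter> J = J" using J by auto
  moreover have "\<H>(?L) \<le> \<H>(?E ({1..n} - J))
      + (\<Sum>i\<in>{1..n} \<inter> J. \<H>((T i) | (\<lambda>\<omega>. map (\<lambda>l. T l \<omega>) [1..<i])))"
    by (rule entropy_list_le_remaining[OF T])
  ultimately show ?thesis by (simp del: upt_Suc)
qed

theorem theorem1:
  fixes P :: "'w measure"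
    and V :: "'v set"
    and t :: "nat \<Rightarrow> nat \<Rightarrow> 'w \<Rightarrow> 'v"
    and m :: "nat \<Rightarrow> nat"
    and N K :: nat
    and A :: "'w \<Rightarrow> 'a"
    and B :: "'a set"
    and k :: "nat \<Rightarrow> nat"
  assumes "prob_space P"
    and "finite V"
    and "1 \<le> N"
    and "\<And>i. i \<in> {1..N} \<Longrightarrow> 1 \<le> m i"
    and "\<And>i j. i \<in> {1..N} \<Longrightarrow> j \<in> {1..m i} \<Longrightarrow> t i j \<in> P \<rightarrow>\<^sub>M count_space V"
    and "countable B"
    and "A \<in> P \<rightarrow>\<^sub>M count_space B"
    and "inj_on k {0..K}"
    and "k ` {0..K} \<subseteq> {1..N}"
  shows "cond_mutual_info P (step_tuple t m (k ` {0..K})) A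
           (step_tuple t m ({1..N} - k ` {0..K}))
         \<le> (\<Sum>i=0..K. step_entropy P t m (k i))"
proof -
  interpret prob_space P by fact
  interpret information_space P 2 by standard simp
  let ?J = "k ` {0..K}"
  have sT: "simple_function P (t i j)" if "i \<in> {1..N}" "j \<in> {1..m i}" for i j
  proof -
    note ti = assms(5)[OF that]
    have "t i j ` space P \<subseteq> V" using measurable_space[OF ti] by auto
    then have "finite (t i j ` space P)" using \<open>finite V\<close> by (rule finite_subset)
    moreover have "t i j \<in> P \<rightarrow>\<^sub>M count_space (t i j ` space P)"
      by (rule measurable_count_space_range(2)[OF countable_finite[OF \<open>finite V\<close>] ti])
    ultimately show ?thesis by (simp add: simple_function_def measurable_count_space_eq2)
  qed
  have S: "simple_function P (step t m i)" if "i \<in> {1..N}" for i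
    unfolding step_def using that by (intro simple_function_map sT) auto
  have tup: "simple_function P (step_tuple t m I)" if "I \<subseteq> {1..N}" for I
  proof -
    have "step_tuple t m I = (\<lambda>l. \<lambda>i\<in>I. l ! (i - 1)) \<circ> (\<lambda>\<omega>. map (\<lambda>i. step t m i \<omega>) [1..<Suc N])"
      using that by (force simp: step_tuple_def fun_eq_iff restrict_def simp del: upt_Suc)
    moreover have "simple_function P (\<lambda>\<omega>. map (\<lambda>i. step t m i \<omega>) [1..<Suc N])"
      by (intro simple_function_map S) auto
    ultimately show ?thesis using simple_function_compose by metis
  qed
  have "cond_mutual_info P (step_tuple t m ?J) A (step_tuple t m ({1..N} - ?J))
      \<le> cond_entropy P (step_tuple t m ?J) (step_tuple t m ({1..N} - ?J))"
    by (rule cond_mutual_info_le_cond_entropy[OF assms(1) tup[OF assms(9)] tup[OF Diff_subset] assms(6,7)])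
  also have "\<dots> \<le> (\<Sum>i\<in>?J. cond_entropy P (step t m i) (earlier_steps t m i))"
    using conditional_entropy_remaining_le[where T="step t m", OF S assms(9)]
    unfolding cond_entropy_def step_tuple_def earlier_steps_def by simp
  \<comment> \<open>The chain rule over the tokens of a single step turns the entropy of a whole
    step into the token sum that defines the step entropy.\<close>
  also have "\<dots> = (\<Sum>i\<in>?J. step_entropy P t m i)"
    using assms(9) by (intro sum.cong refl step_entropy_eq[symmetric, OF assms(1,2)] assms(5)) auto
  also have "\<dots> = (\<Sum>i=0..K. step_entropy P t m (k i))"
    using assms(8) by (simp add: sum.reindex)
  finally show ?thesis .
qed

end
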